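(* Let $n\ge 3$ be an integer and let $p$ be an integer with $0\le p<f_n$. Then (each line holding whenever its condition does) \[ \# P\bigl(\mathring\omega_n,1,\overline{f_{n-1}p}\bigr)= \begin{cases} f_n-2p & (0\le p\le f_{n-2}),\\ f_{n-3} & (f_{n-2}\le p\le f_{n-1}),\\ 2p-f_n & (f_{n-1}\le p<f_n). \end{cases} \]
   Context: The Fibonacci numbers are $f_0=1$, $f_1=1$, $f_i=f_{i-1}+f_{i-2}$ for $i\ge 2$. For a positive integer $m$ let $[m]=\{1,\dots,m\}$. A word of length $m$ is a map $[m]\to\{0,1\}$, written as a sequence; $x\cdot x'$ denotes concatenation. The Fibonacci words are $\omega_0=(0)$, $\omega_1=(1)$, $\omega_n=\omega_{n-1}\cdot\omega_{n-2}$ for $n\ge2$; $\omega_n$ has length $f_n$. Let $I_n=\mathbb{Z}/f_n\mathbb{Z}$, and let $\overline{i}$ be the class of $i$. The cyclic Fibonacci word $\mathring\omega_n:I_n\to\{0,1\}$ is defined by $\mathring\omega_n(\overline{i})=\omega_n(i)$ for $i\in[f_n]$. For a map $w:I\to\{0,1\}$ with $I=\mathbb{Z}/m\mathbb{Z}$, an integer $s>0$ and $\delta\in I$, let $P(w,s)=\{(\iota,\kappa)\in I\times I : w(\iota+\overline{t-1})=w(\kappa+\overline{t-1}) \text{ for all } t\in[s]\}$ and $P(w,s,\delta)=\{(\iota,\kappa)\in P(w,s):\iota-\kappa=\delta\}$. *)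

theory Defs
  imports "HOL-Number_Theory.Number_Theory"
begin

text \<open>The library's \<open>fib\<close> starts with \<open>fib 0 = 0\<close>; the convention here is \<open>f\<^sub>0 = f\<^sub>1 = 1\<close>.\<close>

definition fibn :: "nat \<Rightarrow> nat" where
  "fibn n = fib (Suc n)"

lemma fibn_simps:
  "fibn 0 = 1"
  "fibn 1 = 1"
  "n \<ge> 2 \<Longrightarrow> fibn n = fibn (n - 1) + fibn (n - 2)"
proof -
  assume "n \<ge> 2"
  then obtain k where "n = Suc (Suc k)"
    by (metis add_2_eq_Suc le_Suc_ex)
  then show "fibn n = fibn (n - 1) + fibn (n - 2)"
    by (simp add: fibn_def)
qed (simp_all add: fibn_def)

text \<open>A word of length \<open>m\<close> is a list of length \<open>m\<close> with entries in \<open>{0, 1}\<close>.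
  Positions in words are numbered from \<open>1\<close>, whereas list indices start at \<open>0\<close>.\<close>

definition letter :: "nat list \<Rightarrow> nat \<Rightarrow> nat" where
  "letter u i = u ! (i - 1)"

fun fib_word :: "nat \<Rightarrow> nat list" where
  "fib_word 0 = [0]"
| "fib_word (Suc 0) = [1]"
| "fib_word (Suc (Suc n)) = fib_word (Suc n) @ fib_word n"

lemma length_fib_word: "length (fib_word n) = fibn n"
  by (induction n rule: fib_word.induct) (simp_all add: fibn_def)

lemma set_fib_word: "set (fib_word n) \<subseteq> {0, 1}"
  by (induction n rule: fib_word.induct) auto

text \<open>\<open>\<int>/m\<int>\<close> is the library's \<open>residue_ring m\<close>, whose elements are the representatives
  \<open>0, \<dots>, m - 1\<close> of the residue classes.\<close>

abbreviation Zmod :: "nat \<Rightarrow> int ring" where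
  "Zmod m \<equiv> residue_ring (int m)"

definition residue_cls :: "nat \<Rightarrow> int \<Rightarrow> int" where
  "residue_cls m i = i mod int m"

text \<open>The class \<open>x\<close> has the unique representative \<open>(x - 1) mod f\<^sub>n + 1\<close> in
  \<open>{1, \<dots>, f\<^sub>n}\<close>; see \<open>cyclic_fib_word_class\<close> below.\<close>

definition cyclic_fib_word :: "nat \<Rightarrow> int \<Rightarrow> nat" where
  "cyclic_fib_word n x = letter (fib_word n) (nat ((x - 1) mod int (fibn n)) + 1)"

lemma cyclic_fib_word_class:
  assumes "i \<in> {1..fibn n}"
  shows "cyclic_fib_word n (residue_cls (fibn n) (int i)) = letter (fib_word n) i"
proof -
  have "(int i mod int (fibn n) - 1) mod int (fibn n) = (int i - 1) mod int (fibn n)"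
    by (simp add: mod_diff_left_eq)
  also have "\<dots> = int i - 1"
    using assms by (intro mod_pos_pos_trivial) auto
  finally show ?thesis
    using assms by (simp add: cyclic_fib_word_def residue_cls_def nat_diff_distrib)
qed

definition P_pairs :: "nat \<Rightarrow> (int \<Rightarrow> nat) \<Rightarrow> nat \<Rightarrow> (int \<times> int) set" where
  "P_pairs m w s = {(\<iota>, \<kappa>) \<in> carrier (Zmod m) \<times> carrier (Zmod m).
     \<forall>t\<in>{1..s}. w (\<iota> \<oplus>\<^bsub>Zmod m\<^esub> residue_cls m (int t - 1))
               = w (\<kappa> \<oplus>\<^bsub>Zmod m\<^esub> residue_cls m (int t - 1))}"

definition P_pairs_diff :: "nat \<Rightarrow> (int \<Rightarrow> nat) \<Rightarrow> nat \<Rightarrow> int \<Rightarrow> (int \<times> int) set" where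
  "P_pairs_diff m w s \<delta> = {(\<iota>, \<kappa>) \<in> P_pairs m w s. \<iota> \<ominus>\<^bsub>Zmod m\<^esub> \<kappa> = \<delta>}"

end

theory Submission
  imports Defs
begin

text \<open>
  Put \<open>F = f\<^sub>n\<close>, \<open>f = f\<^sub>n\<^sub>-\<^sub>1\<close> and \<open>a = f\<^sub>n\<^sub>-\<^sub>2\<close>. The two factors of
  \<open>\<omega>\<^sub>n = \<omega>\<^sub>n\<^sub>-\<^sub>1 \<cdot> \<omega>\<^sub>n\<^sub>-\<^sub>2\<close> almost commute: exchanging them only exchanges the last two letters
  (\<open>fib_word_near_commute\<close>). Exchanging them is also the rotation of \<open>\<omega>\<^sub>n\<close> by \<open>f\<close>, so a walk
  around \<open>\<int>/F\<int>\<close> in steps of \<open>f\<close> reads a constant letter except at the two steps that leave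
  the last two positions. As \<open>f\<close> is coprime to \<open>F\<close>, the walk visits every position once;
  hence along the walk the zeros form one arc. Cassini's identity gives
  \<open>f a \<equiv> \<plusminus>1 (mod F)\<close>, which says that the two exceptional steps are \<open>a\<close> apart, so the arc has
  length \<open>a\<close> (\<open>fib_word_zeros_arc\<close>).

  In the coordinate along the walk, a shift by \<open>f p\<close> becomes a shift by \<open>p\<close>. So the number
  in question counts the points of a cycle of length \<open>F\<close> that lie in an arc of length \<open>a\<close> if
  and only if their shift by \<open>p\<close> does. Because \<open>2 a \<le> F\<close>, exactly \<open>min p (min a (F - p))\<close>
  points leave the arc, and as many enter it (\<open>card_arc_agree\<close>), which yields the three cases;
  in the middle one, \<open>F - 2 a = f\<^sub>n\<^sub>-\<^sub>3\<close>.
\<close>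

section \<open>The letters of a Fibonacci word along steps of the previous Fibonacci number\<close>

lemma fib_word_near_commute:
  "\<exists>u. fib_word (Suc k) @ fib_word k = u @ (if even k then [1, 0] else [0, 1]) \<and>
       fib_word k @ fib_word (Suc k) = u @ (if even k then [0, 1] else [1, 0])"
proof (induction k)
  case 0
  then show ?case by simp
next
  case (Suc k)
  then obtain u where
    u: "fib_word (Suc k) @ fib_word k = u @ (if even k then [1, 0] else [0, 1])" and
    u': "fib_word k @ fib_word (Suc k) = u @ (if even k then [0, 1] else [1, 0])"
    by blast
  have "fib_word (Suc (Suc k)) @ fib_word (Suc k)
      = fib_word (Suc k) @ (fib_word k @ fib_word (Suc k))"
    by simp
  moreover have "fib_word (Suc k) @ fib_word (Suc (Suc k))
      = fib_word (Suc k) @ (fib_word (Suc k) @ fib_word k)"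
    by simp
  ultimately show ?case
    unfolding u u' by (intro exI[of _ "fib_word (Suc k) @ u"]) (simp del: fib_word.simps)
qed

text \<open>The letter at a position modulo \<open>f\<^sub>n\<close>, counted from \<open>0\<close>; unlike \<^const>\<open>cyclic_fib_word\<close>,
  this numbering makes the last two positions \<open>-2\<close> and \<open>-1\<close>.\<close>

definition cyc :: "nat \<Rightarrow> int \<Rightarrow> nat" where
  "cyc n x = fib_word n ! nat (x mod int (fibn n))"

lemma cyclic_fib_word_eq_cyc: "cyclic_fib_word n x = cyc n (x - 1)"
  by (simp add: cyclic_fib_word_def cyc_def letter_def)

lemma cyc_cong: "[x = y] (mod int (fibn n)) \<Longrightarrow> cyc n x = cyc n y"
  by (simp add: cyc_def cong_def)

lemma fibn_Suc_Suc: "fibn (Suc (Suc k)) = fibn (Suc k) + fibn k"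
  by (simp add: fibn_def)

lemma fibn_pos: "fibn k > 0"
  by (simp add: fibn_def fib_neq_0_nat)

lemma coprime_fibn: "coprime (int (fibn (Suc k))) (int (fibn (Suc (Suc k))))"
  unfolding fibn_def coprime_int_iff by (rule coprime_fib_Suc_nat)

text \<open>The near commutation, read cyclically: rotating \<open>\<omega>\<^sub>n\<close> by \<open>f\<^sub>n\<^sub>-\<^sub>1\<close> exchanges its two factors,
  hence changes nothing before the last two positions.\<close>

lemma cyc_step:
  fixes k :: nat
  defines "F \<equiv> int (fibn (Suc (Suc k)))" and "f \<equiv> int (fibn (Suc k))"
  shows cyc_step_same: "\<lbrakk>\<not> [x = -1] (mod F); \<not> [x = -2] (mod F)\<rbrakk>
          \<Longrightarrow> cyc (Suc (Suc k)) (x + f) = cyc (Suc (Suc k)) x"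
    and cyc_step_last: "cyc (Suc (Suc k)) (f - 1) = (if even k then 1 else 0)"
    and cyc_step_last2: "cyc (Suc (Suc k)) (f - 2) = (if even k then 0 else 1)"
proof -
  let ?n = "Suc (Suc k)"
  obtain u where u: "fib_word (Suc k) @ fib_word k = u @ (if even k then [1, 0] else [0, 1])"
    and u': "fib_word k @ fib_word (Suc k) = u @ (if even k then [0, 1] else [1, 0])"
    using fib_word_near_commute by blast
  have len: "fibn ?n = length u + 2"
    using arg_cong[OF u, of length] by (simp add: length_fib_word fibn_Suc_Suc split: if_splits)
  have rot: "cyc ?n (x + f) = (fib_word k @ fib_word (Suc k)) ! nat (x mod F)" for x
  proof -
    have lt: "nat (x mod F) < length (fib_word ?n)"
      using pos_mod_bound[of F x] fibn_pos[of ?n] pos_mod_sign[of F x]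
      unfolding length_fib_word F_def by linarith
    have "fib_word k @ fib_word (Suc k) = rotate (fibn (Suc k)) (fib_word ?n)"
      using rotate_append[of "fib_word (Suc k)" "fib_word k"] by (simp add: length_fib_word)
    then have "(fib_word k @ fib_word (Suc k)) ! nat (x mod F)
        = fib_word ?n ! ((fibn (Suc k) + nat (x mod F)) mod fibn ?n)"
      using lt by (simp only: nth_rotate length_fib_word)
    also have "(fibn (Suc k) + nat (x mod F)) mod fibn ?n = nat ((x + f) mod F)"
    proof -
      have "int ((fibn (Suc k) + nat (x mod F)) mod fibn ?n) = (f + x mod F) mod F"
        using len by (simp add: F_def f_def zmod_int)
      also have "\<dots> = (x + f) mod F"
        by (simp add: mod_add_right_eq add.commute)
      finally show ?thesis by (metis nat_int)
    qed
    finally show ?thesis by (simp add: cyc_def F_def)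
  qed
  have F: "F = int (length u) + 2" using len by (simp add: F_def)
  have m1: "(-1) mod F = F - 1" and m2: "(-2) mod F = F - 2"
    using F mod_pos_pos_trivial[of "F - 1" F] mod_pos_pos_trivial[of "F - 2" F]
      minus_mod_self2[of "F - 1" F] minus_mod_self2[of "F - 2" F] by simp_all
  show "cyc ?n (x + f) = cyc ?n x" if "\<not> [x = -1] (mod F)" "\<not> [x = -2] (mod F)"
  proof -
    have "x mod F < F" by (rule pos_mod_bound) (simp only: F)
    then have "x mod F < F - 2"
      using that m1 m2 unfolding cong_def by linarith
    then have "nat (x mod F) < length u"
      using F pos_mod_sign[of F x] by linarith
    then show ?thesis
      unfolding rot u' using u by (simp add: cyc_def F_def nth_append)
  qed
  show "cyc ?n (f - 1) = (if even k then 1 else 0)"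
    using rot[of "-1"] F m1 by (simp add: u' nth_append)
  show "cyc ?n (f - 2) = (if even k then 0 else 1)"
    using rot[of "-2"] F m2 by (simp add: u' nth_append)
qed

text \<open>Cassini's identity, with \<open>f\<^sub>k = f\<^sub>k\<^sub>+\<^sub>2 - f\<^sub>k\<^sub>+\<^sub>1\<close>.\<close>

lemma fibn_mult_cong:
  "[int (fibn (Suc k)) * int (fibn k) = (-1) ^ k] (mod int (fibn (Suc (Suc k))))"
proof -
  let ?F = "int (fibn (Suc (Suc k)))" and ?f = "int (fibn (Suc k))" and ?a = "int (fibn k)"
  have "?F * ?a - ?f\<^sup>2 = (-1) ^ k"
    using fib_Cassini_int[of "Suc k"] by (simp add: fibn_def)
  moreover have "?F = ?f + ?a" by (simp add: fibn_Suc_Suc)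
  ultimately have "?f * ?a - (-1) ^ k = ?F * (?f - ?a)"
    by (simp add: algebra_simps power2_eq_square)
  then show ?thesis by (simp add: cong_iff_dvd_diff)
qed

text \<open>Of the two exceptional steps, the one from position \<open>-c\<close> turns a one into a zero, and the
  arc starts just after it; which of the positions \<open>-1\<close> and \<open>-2\<close> this is depends on the parity.
  The other exceptional step leaves position \<open>(-1)\<^sup>k - c\<close>, and by Cassini's identity the walk gets
  there in \<open>f\<^sub>k\<close> steps from \<open>-c\<close>; it gets there only once in a round because \<open>f\<^sub>k\<^sub>+\<^sub>1\<close> is
  invertible.\<close>

lemma fib_word_zeros_arc:
  fixes k :: nat
  defines "F \<equiv> int (fibn (Suc (Suc k)))" and "f \<equiv> int (fibn (Suc k))"
    and "c \<equiv> (if even k then 2 else 1 :: int)"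
  assumes "int j < F"
  shows "cyc (Suc (Suc k)) (f * (int j + 1) - c) = (if j < fibn k then 0 else 1)"
  using assms(4)
proof (induction j)
  case 0
  then show ?case
    using cyc_step_last[of k] cyc_step_last2[of k] fibn_pos[of k] by (simp add: c_def f_def)
next
  case (Suc j)
  let ?n = "Suc (Suc k)" and ?a = "fibn k"
  define x where "x = f * (int j + 1) - c"
  have IH: "cyc ?n x = (if j < ?a then 0 else 1)"
    using Suc by (simp add: x_def)
  have goal_eq: "f * (int (Suc j) + 1) - c = x + f"
    by (simp add: x_def algebra_simps)
  have fa: "[f * int ?a = (-1) ^ k] (mod F)"
    using fibn_mult_cong by (simp add: f_def F_def)
  have cop: "coprime f F"
    using coprime_fibn by (simp add: f_def F_def)
  show ?case
  proof (cases "Suc j = ?a")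
    case True
    then have "int j + 1 = int ?a" by simp
    then have "[x = (-1) ^ k - c] (mod F)"
      unfolding x_def using cong_diff[OF fa cong_refl[of c]] by simp
    then have "cyc ?n (x + f) = cyc ?n ((-1) ^ k - c + f)"
      by (intro cyc_cong) (simp add: F_def cong_add_rcancel)
    also have "\<dots> = 1"
      using cyc_step_last[of k] cyc_step_last2[of k]
      by (cases "even k") (simp_all add: c_def f_def)
    finally show ?thesis using True goal_eq by simp
  next
    case False
    have n0: "\<not> [f * (int j + 1) = 0] (mod F)"
    proof
      assume "[f * (int j + 1) = 0] (mod F)"
      then have "F dvd int j + 1"
        using cop by (simp add: cong_0_iff coprime_commute coprime_dvd_mult_right_iff)
      then show False using Suc.prems zdvd_imp_le[of F "int j + 1"] by simp
    qed
    have n1: "\<not> [f * (int j + 1) = (-1) ^ k] (mod F)"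
    proof
      assume "[f * (int j + 1) = (-1) ^ k] (mod F)"
      then have "[f * (int j + 1) = f * int ?a] (mod F)"
        using fa by (meson cong_sym cong_trans)
      then have "[int j + 1 = int ?a] (mod F)"
        using cop by (simp add: cong_mult_lcancel)
      then have "int j + 1 = int ?a"
        using Suc.prems fibn_pos[of "Suc k"]
        by (intro cong_less_imp_eq_int[of _ F]) (simp_all add: F_def fibn_Suc_Suc)
      then show False using False by simp
    qed
    have shift: "[x = d] (mod F) \<longleftrightarrow> [f * (int j + 1) = d + c] (mod F)" for d
      by (simp add: x_def cong_iff_dvd_diff algebra_simps)
    have "cyc ?n (x + f) = cyc ?n x"
      using n0 n1 shift[of "-1"] shift[of "-2"]
      unfolding f_def F_def by (intro cyc_step_same) (auto simp: c_def split: if_splits)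
    then show ?thesis using IH goal_eq False by auto
  qed
qed

section \<open>Counting coincidences\<close>

text \<open>On a cycle of length \<open>F\<close>, the arc of the first \<open>a\<close> points and its translate by \<open>-p\<close>
  overlap at one end (\<open>p \<le> a\<close>), are disjoint (\<open>a \<le> p \<le> F - a\<close>), or overlap at the other end.
  In each case the points lying in both arcs or in neither form two intervals of
  representatives.\<close>

lemma card_arc_agree:
  fixes F a p :: int
  assumes "0 \<le> a" "2 * a \<le> F" "0 \<le> p" "p < F"
  shows "int (card {j \<in> {0..<F}. (j < a) = ((j + p) mod F < a)}) = F - 2 * min p (min a (F - p))"
proof -
  have md: "(j + p) mod F = (if j + p < F then j + p else j + p - F)" if "j \<in> {0..<F}" for j
    using that assms mod_pos_pos_trivial[of "j + p" F] mod_pos_pos_trivial[of "j + p - F" F]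
      minus_mod_self2[of "j + p" F] by simp
  consider "p \<le> a" | "a \<le> p" "p \<le> F - a" | "F - a \<le> p" by linarith
  then show ?thesis
  proof cases
    case 1
    then have "{j \<in> {0..<F}. (j < a) = ((j + p) mod F < a)} = {0..<a - p} \<union> {a..<F - p}"
      using assms by (auto simp: md split: if_splits)
    moreover have "card ({0..<a - p} \<union> {a..<F - p}) = nat (a - p) + nat (F - p - a)"
      using 1 assms by (subst card_Un_disjoint) auto
    ultimately show ?thesis using 1 assms by simp
  next
    case 2
    then have "{j \<in> {0..<F}. (j < a) = ((j + p) mod F < a)} = {a..<F - p} \<union> {F - p + a..<F}"
      using assms by (auto simp: md split: if_splits)
    moreover have "card ({a..<F - p} \<union> {F - p + a..<F}) = nat (F - p - a) + nat (p - a)"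
      using 2 assms by (subst card_Un_disjoint) auto
    ultimately show ?thesis using 2 assms by simp
  next
    case 3
    then have "{j \<in> {0..<F}. (j < a) = ((j + p) mod F < a)} = {F - p..<a} \<union> {F - p + a..<F}"
      using assms by (auto simp: md split: if_splits)
    moreover have "card ({F - p..<a} \<union> {F - p + a..<F}) = nat (a - (F - p)) + nat (p - a)"
      using 3 assms by (subst card_Un_disjoint) auto
    ultimately show ?thesis using 3 assms by simp
  qed
qed

lemma card_P_pairs_diff_one:
  assumes "m > 1"
  shows "card (P_pairs_diff m w 1 (residue_cls m d))
       = card {\<kappa> \<in> {0..<int m}. w \<kappa> = w ((\<kappa> + d) mod int m)}"
proof -
  interpret residues "int m" "Zmod m"
    using assms by unfold_locales simp_all
  have diff: "\<iota> \<ominus>\<^bsub>Zmod m\<^esub> \<kappa> = (\<iota> - \<kappa>) mod int m" for \<iota> \<kappa>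
    using assms by (simp add: a_minus_def res_neg_eq res_add_eq mod_add_right_eq)
  have eq: "(\<iota> - \<kappa>) mod int m = d mod int m \<longleftrightarrow> \<iota> = (\<kappa> + d) mod int m"
    if "\<iota> \<in> {0..<int m}" for \<iota> \<kappa>
  proof -
    have "(\<iota> - \<kappa>) mod int m = d mod int m \<longleftrightarrow> [\<iota> = \<kappa> + d] (mod int m)"
      by (simp add: cong_def[symmetric] cong_iff_dvd_diff algebra_simps)
    also have "\<dots> \<longleftrightarrow> \<iota> = (\<kappa> + d) mod int m"
      using that by (simp add: cong_def)
    finally show ?thesis .
  qed
  have "P_pairs_diff m w 1 (residue_cls m d)
      = (\<lambda>\<kappa>. ((\<kappa> + d) mod int m, \<kappa>)) ` {\<kappa> \<in> {0..<int m}. w \<kappa> = w ((\<kappa> + d) mod int m)}"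
    (is "?L = ?R")
  proof -
    have carr: "carrier (Zmod m) = {0..<int m}"
      by (auto simp: res_carrier_eq)
    have "?L = {(\<iota>, \<kappa>). \<iota> \<in> {0..<int m} \<and> \<kappa> \<in> {0..<int m} \<and> w \<iota> = w \<kappa> \<and>
                    (\<iota> - \<kappa>) mod int m = d mod int m}"
      unfolding P_pairs_diff_def P_pairs_def diff carr
      by (auto simp: residue_cls_def res_add_eq)
    also have "\<dots> = ?R"
      using assms by (auto simp: eq)
    finally show ?thesis .
  qed
  moreover have "inj_on (\<lambda>\<kappa>. ((\<kappa> + d) mod int m, \<kappa>)) A" for A
    by (auto simp: inj_on_def)
  ultimately show ?thesis by (simp add: card_image)
qed

lemma bij_betw_affine_mod:
  fixes F f b :: int
  assumes "F > 0" "coprime f F"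
  shows "bij_betw (\<lambda>j. (f * j + b) mod F) {0..<F} {0..<F}"
proof -
  have "inj_on (\<lambda>j. (f * j + b) mod F) {0..<F}"
  proof (rule inj_onI)
    fix i j assume "i \<in> {0..<F}" "j \<in> {0..<F}" "(f * i + b) mod F = (f * j + b) mod F"
    moreover from this have "[i = j] (mod F)"
      using assms(2) by (simp add: cong_def[symmetric] cong_add_rcancel cong_mult_lcancel)
    ultimately show "i = j"
      by (simp add: cong_def)
  qed
  moreover have "(\<lambda>j. (f * j + b) mod F) ` {0..<F} \<subseteq> {0..<F}"
    using assms(1) by auto
  ultimately show ?thesis
    by (simp add: bij_betw_def endo_inj_surj)
qed

text \<open>The letters are compared along the walk \<open>g\<close>, on which the zeros are an arc and the shift by
  \<open>f p\<close> is the shift by \<open>p\<close>. The minimum treats the three cases of the theorem at once.\<close>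

lemma card_P_pairs_diff_cyclic_fib_word:
  fixes k :: nat and p :: int
  defines "F \<equiv> int (fibn (Suc (Suc k)))" and "f \<equiv> int (fibn (Suc k))" and "a \<equiv> int (fibn k)"
  assumes p: "0 \<le> p" "p < F"
  shows "int (card (P_pairs_diff (fibn (Suc (Suc k))) (cyclic_fib_word (Suc (Suc k))) 1
                (residue_cls (fibn (Suc (Suc k))) (f * p)))) = F - 2 * min p (min a (F - p))"
proof -
  let ?n = "Suc (Suc k)"
  let ?w = "cyclic_fib_word ?n"
  define c where "c = (if even k then 2 else 1 :: int)"
  \<comment> \<open>The offset is the one of \<open>fib_word_zeros_arc\<close>, plus \<open>1\<close> because \<open>cyclic_fib_word\<close>
    numbers positions from \<open>1\<close>.\<close>
  define g where "g j = (f * j + (f - c + 1)) mod F" for j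
  have bij: "bij_betw g {0..<F} {0..<F}"
    unfolding g_def using coprime_fibn fibn_pos
    by (intro bij_betw_affine_mod) (simp_all add: f_def F_def)
  have shift: "(g j + f * p) mod F = g ((j + p) mod F)" for j
  proof -
    have "g ((j + p) mod F) = (f * (j + p) + (f - c + 1)) mod F"
      unfolding g_def by (metis mod_add_left_eq mod_mult_right_eq)
    also have "f * (j + p) + (f - c + 1) = f * j + (f - c + 1) + f * p"
      by (simp add: algebra_simps)
    finally show ?thesis
      unfolding g_def by (simp only: mod_add_left_eq)
  qed
  have Fpos: "F > 0" using p by simp
  have w_g: "?w (g j) = (if j < a then 0 else 1)" if "j \<in> {0..<F}" for j
  proof -
    have "j = int (nat j)" using that by simp
    then obtain i where i: "j = int i" ..
    have "?w (g j) = cyc ?n (f * (int i + 1) - c)"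
    proof -
      have "(g j - 1) mod F = (f * j + (f - c + 1) - 1) mod F"
        unfolding g_def by (rule mod_diff_left_eq)
      also have "f * j + (f - c + 1) - 1 = f * (int i + 1) - c"
        by (simp add: i algebra_simps)
      finally show ?thesis
        by (simp only: cyclic_fib_word_eq_cyc cyc_def F_def)
    qed
    also have "\<dots> = (if i < fibn k then 0 else 1)"
      using fib_word_zeros_arc[of i k] that i by (simp add: F_def f_def c_def)
    finally show ?thesis using i by (simp add: a_def)
  qed
  have w_eq: "?w (g j) = ?w ((g j + f * p) mod F) \<longleftrightarrow> (j < a) = ((j + p) mod F < a)"
    if "j \<in> {0..<F}" for j
    using w_g[OF that] w_g[of "(j + p) mod F"] Fpos by (auto simp: shift)
  have "{\<kappa> \<in> {0..<F}. ?w \<kappa> = ?w ((\<kappa> + f * p) mod F)}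
      = g ` {j \<in> {0..<F}. (j < a) = ((j + p) mod F < a)}" (is "?K = g ` ?J")
  proof -
    have "?K = {\<kappa> \<in> g ` {0..<F}. ?w \<kappa> = ?w ((\<kappa> + f * p) mod F)}"
      by (simp only: bij_betw_imp_surj_on[OF bij])
    also have "\<dots> = g ` {j \<in> {0..<F}. ?w (g j) = ?w ((g j + f * p) mod F)}"
      by (rule Compr_image_eq)
    also have "\<dots> = g ` ?J" using w_eq by (intro arg_cong[of _ _ "image g"] Collect_cong) blast
    finally show ?thesis .
  qed
  moreover have "inj_on g ?J"
    using bij by (auto simp: bij_betw_def intro: inj_on_subset)
  moreover have "fibn ?n > 1"
    using fibn_pos[of k] fibn_pos[of "Suc k"] by (simp add: fibn_Suc_Suc)
  ultimately have "card (P_pairs_diff (fibn ?n) ?w 1 (residue_cls (fibn ?n) (f * p))) = card ?J"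
    by (simp only: card_P_pairs_diff_one F_def card_image)
  moreover have "2 * a \<le> F"
    using fib_mono[of "Suc k" "Suc (Suc k)"] by (simp add: a_def F_def fibn_def)
  ultimately show ?thesis
    using card_arc_agree[of a F p] p by (simp add: a_def)
qed

theorem theorem2p3:
  fixes n :: nat and p :: int
  assumes "n \<ge> 3" and "0 \<le> p" and "p < int (fibn n)"
  defines "N \<equiv> int (card (P_pairs_diff (fibn n) (cyclic_fib_word n) 1
                   (residue_cls (fibn n) (int (fibn (n - 1)) * p))))"
  shows "(0 \<le> p \<and> p \<le> int (fibn (n - 2)) \<longrightarrow> N = int (fibn n) - 2 * p) \<and>
         (int (fibn (n - 2)) \<le> p \<and> p \<le> int (fibn (n - 1)) \<longrightarrow> N = int (fibn (n - 3))) \<and>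
         (int (fibn (n - 1)) \<le> p \<and> p < int (fibn n) \<longrightarrow> N = 2 * p - int (fibn n))"
proof -
  obtain l where n: "n = Suc (Suc (Suc l))"
    using le_Suc_ex[OF assms(1)] by (auto simp: numeral_3_eq_3)
  have "N = int (fibn n) - 2 * min p (min (int (fibn (n - 2))) (int (fibn n) - p))"
    unfolding N_def using card_P_pairs_diff_cyclic_fib_word[of p "Suc l"] assms(2,3)
    by (simp add: n)
  moreover have "fibn n = fibn (n - 1) + fibn (n - 2)" "fibn (n - 1) = fibn (n - 2) + fibn (n - 3)"
    by (simp_all add: n fibn_Suc_Suc)
  ultimately show ?thesis using assms(2) by auto
qed

end
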